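(* For every finite simple graph $G$ with at least one vertex and every field $\mathbb{F}$, the following inequality holds: $\overline{\xi}_{\mathbb{F}}(G)\geq \operatorname{Xind}(\operatorname{Hom}(K_2,G))+2$.
   Context: Orthogonality dimension: given a field $\mathbb{F}$, a $t$-dimensional orthogonal representation of a graph $G$ over $\mathbb{F}$ is an assignment of a vector $\boldsymbol{x}_v\in\mathbb{F}^t$ to each vertex $v$ of $G$ such that $\langle\boldsymbol{x}_u,\boldsymbol{x}_u\rangle\neq 0$ for every vertex $u$ and $\langle\boldsymbol{x}_u,\boldsymbol{x}_v\rangle=0$ for every edge $uv$. Here $\langle\boldsymbol{y},\boldsymbol{z}\rangle=\sum_i y_iz_i$; when $\mathbb{F}=\mathbb{C}$ one may alternatively take $\langle\boldsymbol{y},\boldsymbol{z}\rangle=\sum_i y_i\overline{z_i}$, and the result is asserted for either choice. The orthogonality dimension $\overline{\xi}_{\mathbb{F}}(G)$ is the smallest $t$ for which there exists a $t$-dimensional orthogonal representation of $G$ over $\mathbb{F}$. Free $Z_2$-posets and cross-index: a free $Z_2$-poset is a poset with a fixed-point free involution $\nu$ that preserves the order. A map $\phi\colon P\to Q$ between free $Z_2$-posets is an order-preserving $Z_2$-map if it is order-preserving and $\phi(\nu\cdot p)=\nu\cdot\phi(p)$ for all $p\in P$. For an integer $n\ge 0$, $Q_n$ is the free $Z_2$-poset with elements $\{\pm1,\ldots,\pm(n+1)\}$, strict order given by $p<q$ if and only if $|p|<|q|$ (so $-i$ and $+i$ are incomparable), and involution $p\mapsto -p$. The cross-index $\operatorname{Xind}(P)$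 of a nonempty free $Z_2$-poset $P$ is the minimum $n\geq 0$ such that there is an order-preserving $Z_2$-map from $P$ to $Q_n$; by convention $\operatorname{Xind}(\emptyset)=-1$. Hom complex: for a graph $G=(V,E)$, $\operatorname{Hom}(K_2,G)$ is the free $Z_2$-poset of all pairs $(X,Y)$ of nonempty disjoint subsets of $V$ such that every vertex of $X$ is adjacent to every vertex of $Y$, ordered by $(X,Y)\subseteq(X',Y')$ if and only if $X\subseteq X'$ and $Y\subseteq Y'$, with involution $\nu\cdot(X,Y)=(Y,X)$. *)

theory Defs
  imports "Graph_Theory.Digraph" "Jordan_Normal_Form.Matrix"
begin

section \<open>Orthogonality dimension\<close>

text \<open>
  Finite simple graphs are the graphs of the locale \<^locale>\<open>graph\<close>: finite symmetric digraphs
  without loops and parallel arcs, with adjacency \<open>u \<rightarrow>\<^bsub>G\<^esub> v\<close>.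
  The product \<open>ip\<close> is a parameter so that the same definition serves for the bilinear product
  \<open>\<bullet>\<close> over an arbitrary field and for the Hermitian product \<open>\<bullet>c\<close> over the complex numbers.
\<close>

definition orthogonal_representation ::
  "('k vec \<Rightarrow> 'k vec \<Rightarrow> 'k) \<Rightarrow> ('a, 'b) pre_digraph \<Rightarrow> nat \<Rightarrow> ('a \<Rightarrow> 'k::field vec) \<Rightarrow> bool" where
  "orthogonal_representation ip G t x \<longleftrightarrow>
     (\<forall>v\<in>verts G. x v \<in> carrier_vec t) \<and>
     (\<forall>u\<in>verts G. ip (x u) (x u) \<noteq> 0) \<and>
     (\<forall>u v. u \<rightarrow>\<^bsub>G\<^esub> v \<longrightarrow> ip (x u) (x v) = 0)"

definition orthogonality_dimension ::
  "('k::field vec \<Rightarrow> 'k vec \<Rightarrow> 'k) \<Rightarrow> ('a, 'b) pre_digraph \<Rightarrow> nat" where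
  "orthogonality_dimension ip G = (LEAST t. \<exists>x. orthogonal_representation ip G t x)"


section \<open>Free Z2-posets and the cross-index\<close>

record 'p Z2_poset =
  elems :: "'p set"
  leq :: "'p rel"
  nu :: "'p \<Rightarrow> 'p"

locale free_Z2_poset =
  fixes P :: "'p Z2_poset"
  assumes partial_order: "partial_order_on (elems P) (leq P)"
    and nu_closed: "p \<in> elems P \<Longrightarrow> nu P p \<in> elems P"
    and nu_involution: "p \<in> elems P \<Longrightarrow> nu P (nu P p) = p"
    and nu_free: "p \<in> elems P \<Longrightarrow> nu P p \<noteq> p"
    and nu_mono: "(p, q) \<in> leq P \<Longrightarrow> (nu P p, nu P q) \<in> leq P"

definition order_preserving_Z2_map :: "'p Z2_poset \<Rightarrow> 'q Z2_poset \<Rightarrow> ('p \<Rightarrow> 'q) \<Rightarrow> bool" where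
  "order_preserving_Z2_map P Q \<phi> \<longleftrightarrow>
     (\<forall>p\<in>elems P. \<phi> p \<in> elems Q) \<and>
     (\<forall>p q. (p, q) \<in> leq P \<longrightarrow> (\<phi> p, \<phi> q) \<in> leq Q) \<and>
     (\<forall>p\<in>elems P. \<phi> (nu P p) = nu Q (\<phi> p))"

definition Q_poset :: "nat \<Rightarrow> int Z2_poset" where
  "Q_poset n = (let E = {p. 1 \<le> \<bar>p\<bar> \<and> \<bar>p\<bar> \<le> int n + 1} in
     \<lparr> elems = E, leq = {(p, q). p \<in> E \<and> q \<in> E \<and> (p = q \<or> \<bar>p\<bar> < \<bar>q\<bar>)}, nu = uminus \<rparr>)"

definition Xind :: "'p Z2_poset \<Rightarrow> int" where
  "Xind P = (if elems P = {} then -1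
     else int (LEAST n. \<exists>\<phi>. order_preserving_Z2_map P (Q_poset n) \<phi>))"

definition Hom_K2 :: "('a, 'b) pre_digraph \<Rightarrow> ('a set \<times> 'a set) Z2_poset" where
  "Hom_K2 G = (let E = {(X, Y). X \<subseteq> verts G \<and> Y \<subseteq> verts G \<and> X \<noteq> {} \<and> Y \<noteq> {} \<and> X \<inter> Y = {} \<and>
                               (\<forall>x\<in>X. \<forall>y\<in>Y. x \<rightarrow>\<^bsub>G\<^esub> y)} in
     \<lparr> elems = E,
       leq = {((X, Y), (X', Y')). (X, Y) \<in> E \<and> (X', Y') \<in> E \<and> X \<subseteq> X' \<and> Y \<subseteq> Y'},
       nu = (\<lambda>(X, Y). (Y, X)) \<rparr>)"


section \<open>The minima above are attained\<close>

lemma free_Z2_poset_Q_poset: "free_Z2_poset (Q_poset n)"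
  by unfold_locales
    (auto simp: Q_poset_def Let_def partial_order_on_def preorder_on_def refl_on_def
       trans_def antisym_def)

lemma free_Z2_poset_Hom_K2:
  assumes "graph G"
  shows "free_Z2_poset (Hom_K2 G)"
proof -
  interpret graph G by fact
  have sym: "u \<rightarrow>\<^bsub>G\<^esub> v \<Longrightarrow> v \<rightarrow>\<^bsub>G\<^esub> u" for u v
    using arcs_ends_symmetric[OF sym_arcs] .
  show ?thesis
    by unfold_locales
      (auto simp: Hom_K2_def Let_def partial_order_on_def preorder_on_def refl_on_def
         trans_def antisym_def intro: sym)
qed

lemma finite_Hom_K2:
  assumes "graph G"
  shows "finite (elems (Hom_K2 G))"
proof -
  interpret graph G by fact
  have "elems (Hom_K2 G) \<subseteq> Pow (verts G) \<times> Pow (verts G)"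
    by (auto simp: Hom_K2_def Let_def)
  then show ?thesis
    by (rule finite_subset) simp
qed

lemma (in free_Z2_poset) ex_map_to_Q_poset:
  assumes fin: "finite (elems P)"
  shows "\<exists>n \<phi>. order_preserving_Z2_map P (Q_poset n) \<phi>"
proof -
  have leq_elems: "leq P \<subseteq> elems P \<times> elems P"
    using partial_order by (auto simp: partial_order_on_def preorder_on_def)
  have refl: "(p, p) \<in> leq P" if "p \<in> elems P" for p
    using partial_order that by (auto simp: partial_order_on_def preorder_on_def refl_on_def)
  have trans: "(p, r) \<in> leq P" if "(p, q) \<in> leq P" "(q, r) \<in> leq P" for p q r
    using partial_order that unfolding partial_order_on_def preorder_on_def trans_def by blast
  have antisym: "p = q" if "(p, q) \<in> leq P" "(q, p) \<in> leq P" for p q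
    using partial_order that unfolding partial_order_on_def antisym_def by blast
  define D where "D p = {q. (q, p) \<in> leq P}" for p
  have D_sub: "D p \<subseteq> elems P" for p
    using leq_elems by (auto simp: D_def)
  have D_fin: "finite (D p)" for p
    using D_sub fin by (rule finite_subset)
  have D_pos: "1 \<le> card (D p)" if "p \<in> elems P" for p
  proof -
    have "p \<in> D p" using refl[OF that] by (simp add: D_def)
    then have "card (D p) > 0" using D_fin card_gt_0_iff by blast
    then show ?thesis by simp
  qed
  have D_less: "card (D p) < card (D q)" if "(p, q) \<in> leq P" "p \<noteq> q" for p q
  proof (rule psubset_card_mono[OF D_fin])
    have "q \<in> D q" using that leq_elems refl by (auto simp: D_def)
    moreover have "q \<notin> D p" using that antisym by (auto simp: D_def)
    moreover have "D p \<subseteq> D q" using that trans by (auto simp: D_def)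
    ultimately show "D p \<subset> D q" by blast
  qed
  have D_nu: "card (D (nu P p)) = card (D p)" if "p \<in> elems P" for p
  proof (rule sym, rule bij_betw_same_card[where f = "nu P"], rule bij_betw_byWitness[where f' = "nu P"])
    show "\<forall>a\<in>D p. nu P (nu P a) = a" "\<forall>a\<in>D (nu P p). nu P (nu P a) = a"
      using D_sub nu_involution by blast+
    show "nu P ` D p \<subseteq> D (nu P p)" using nu_mono by (auto simp: D_def)
    show "nu P ` D (nu P p) \<subseteq> D p" using nu_mono[of _ "nu P p"] nu_involution[OF that]
      by (auto simp: D_def)
  qed
  define rep where "rep p = (SOME x. x \<in> {p, nu P p})" for p
  have rep_in: "rep p \<in> {p, nu P p}" for p
    unfolding rep_def by (rule someI[of _ p]) simp
  have rep_nu: "rep (nu P p) = rep p" if "p \<in> elems P" for p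
    using nu_involution[OF that] by (simp add: rep_def insert_commute disj_commute)
  define \<phi> where "\<phi> p = (if rep p = p then int (card (D p)) else - int (card (D p)))" for p
  have abs_\<phi>: "\<bar>\<phi> p\<bar> = int (card (D p))" for p
    by (simp add: \<phi>_def)
  have \<phi>_nu: "\<phi> (nu P p) = - \<phi> p" if "p \<in> elems P" for p
    using rep_in[of p] rep_nu[OF that] nu_free[OF that] D_nu[OF that] by (auto simp: \<phi>_def)
  have bound: "card (D p) \<le> card (elems P)" for p
    using D_sub fin by (simp add: card_mono)
  have "order_preserving_Z2_map P (Q_poset (card (elems P))) \<phi>"
  proof -
    have in_E: "1 \<le> \<bar>\<phi> p\<bar> \<and> \<bar>\<phi> p\<bar> \<le> int (card (elems P)) + 1" if "p \<in> elems P" for p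
      using D_pos[OF that] bound[of p] by (simp add: abs_\<phi>)
    have "\<phi> p = \<phi> q \<or> \<bar>\<phi> p\<bar> < \<bar>\<phi> q\<bar>" if "(p, q) \<in> leq P" for p q
      using D_less[OF that] by (cases "p = q") (auto simp: abs_\<phi>)
    then show ?thesis
      using in_E \<phi>_nu leq_elems
      unfolding order_preserving_Z2_map_def Q_poset_def Let_def by auto
  qed
  then show ?thesis by blast
qed

lemma ex_orthogonal_representation:
  assumes "graph G"
  shows "\<exists>t x. orthogonal_representation (\<bullet>) G t (x :: 'a \<Rightarrow> 'k::field vec)"
    and "\<exists>t y. orthogonal_representation (\<bullet>c) G t (y :: 'a \<Rightarrow> complex vec)"
proof -
  interpret graph G by fact
  obtain h :: "'a \<Rightarrow> nat" where h: "bij_betw h (verts G) {0..<card (verts G)}"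
    using ex_bij_betw_finite_nat[OF finite_verts] by blast
  let ?t = "card (verts G)"
  have lt: "h v < ?t" if "v \<in> verts G" for v
    using h that by (auto simp: bij_betw_def)
  have ne: "h u \<noteq> h v \<and> h u < ?t \<and> h v < ?t" if "u \<rightarrow>\<^bsub>G\<^esub> v" for u v
    using adj_not_same adj_in_verts[OF that] that h lt
    by (metis bij_betw_imp_inj_on inj_on_eq_iff)
  have "orthogonal_representation (\<bullet>) G ?t (\<lambda>v. unit_vec ?t (h v) :: 'k vec)"
    unfolding orthogonal_representation_def using lt by (auto dest: ne)
  then show "\<exists>t x. orthogonal_representation (\<bullet>) G t (x :: 'a \<Rightarrow> 'k vec)" by blast
  have conj: "conjugate (unit_vec ?t i :: complex vec) = unit_vec ?t i" for i
    by (rule eq_vecI) (auto simp: unit_vec_def)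
  have "orthogonal_representation (\<bullet>c) G ?t (\<lambda>v. unit_vec ?t (h v) :: complex vec)"
    unfolding orthogonal_representation_def conj using lt by (auto dest: ne)
  then show "\<exists>t y. orthogonal_representation (\<bullet>c) G t (y :: 'a \<Rightarrow> complex vec)" by blast
qed

end

theory Submission
  imports Defs "HOL-Library.Function_Algebras"
begin

text \<open>
  Let \<open>x\<close> be an orthogonal representation of \<open>G\<close> of dimension \<open>t\<close>.  An element \<open>(X, Y)\<close> of
  \<open>Hom(K\<^sub>2, G)\<close> gives two subspaces \<open>U = span x(X)\<close> and \<open>W = span x(Y)\<close> of the \<open>t\<close>-dimensional
  space, orthogonal to each other since \<open>X\<close> and \<open>Y\<close> are completely joined.  The product is
  nondegenerate, so \<open>dim U + dim W \<le> t\<close> (\<open>dim_add_dim_le_of_orthogonal\<close>), and both dimensions are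
  at least \<open>1\<close>; hence the level \<open>dim U + dim W - 1\<close> lies between \<open>1\<close> and \<open>t - 1\<close>, which are
  the absolute values occurring in \<open>Q\<^sub>n\<close> for \<open>n = t - 2\<close>.  The level is monotone in \<open>(X, Y)\<close> and
  invariant under swapping.

  It remains to choose signs.  If two comparable elements have the same level, then both their
  subspaces agree, so a sign that depends only on the pair \<open>(U, W)\<close> causes no conflict.  Swapping
  must flip the sign, which is possible as soon as \<open>U \<noteq> W\<close>; and \<open>U = W\<close> is impossible,
  because then a vector \<open>x(u)\<close> with \<open>u \<in> X\<close> would be orthogonal to itself.  This gives an
  order-preserving \<open>Z\<^sub>2\<close>-map to \<open>Q\<^sub>n\<close> (\<open>Xind_le_of_rank_and_label\<close>).

  Both products of the theorem are instances of \<open>\<Sum>\<^sub>i a\<^sub>i \<sigma>(b\<^sub>i)\<close> for an involution \<open>\<sigma>\<close> of the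
  field: the identity for the bilinear one, complex conjugation for the Hermitian one.
  The argument is carried out for such products.
\<close>

section \<open>Spaces of functions with pointwise scaling\<close>

definition fn_scale :: "'k::field \<Rightarrow> ('i \<Rightarrow> 'k) \<Rightarrow> ('i \<Rightarrow> 'k)" where
  "fn_scale c f = (\<lambda>i. c * f i)"

lemma fn_scale_apply [simp]: "fn_scale c f i = c * f i"
  by (simp add: fn_scale_def)

interpretation fn: vector_space fn_scale
  by unfold_locales (auto simp: fun_eq_iff algebra_simps)

definition fn_unit :: "'i \<Rightarrow> 'i \<Rightarrow> 'k::field" where
  "fn_unit j = (\<lambda>i. if i = j then 1 else 0)"

definition supported :: "'i set \<Rightarrow> ('i \<Rightarrow> 'k::field) set" where
  "supported I = {f. \<forall>i. i \<notin> I \<longrightarrow> f i = 0}"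

lemma supported_subset_span_units:
  fixes I :: "'i set"
  assumes "finite I"
  shows "supported I \<subseteq> (fn.span (fn_unit ` I) :: ('i \<Rightarrow> 'k::field) set)"
proof
  fix f :: "'i \<Rightarrow> 'k"
  assume f: "f \<in> supported I"
  have sum_apply: "(\<Sum>j\<in>J. g j) i = (\<Sum>j\<in>J. g j i)" for J :: "'i set" and g :: "'i \<Rightarrow> 'i \<Rightarrow> 'k" and i
    by (induction J rule: infinite_finite_induct) auto
  have "f = (\<Sum>j\<in>I. fn_scale (f j) (fn_unit j))"
  proof
    fix i
    have "(\<Sum>j\<in>I. fn_scale (f j) (fn_unit j)) i = (\<Sum>j\<in>I. if i = j then f j else 0)"
      unfolding sum_apply by (rule sum.cong) (auto simp: fn_unit_def)
    then show "f i = (\<Sum>j\<in>I. fn_scale (f j) (fn_unit j)) i"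
      using f assms by (simp add: supported_def)
  qed
  also have "\<dots> \<in> fn.span (fn_unit ` I)"
    by (intro fn.span_sum fn.span_scale fn.span_base) auto
  finally show "f \<in> fn.span (fn_unit ` I)" .
qed

lemma subspace_supported: "fn.subspace (supported I)"
  by (auto simp: fn.subspace_def supported_def)

lemma card_units_le: "finite I \<Longrightarrow> card (fn_unit ` I) \<le> card I"
  by (rule card_image_le)

section \<open>Dimension of spans of finite sets\<close>

lemma (in vector_space) dim_mono_finite:
  assumes "S \<subseteq> T" "finite T"
  shows dim_le_of_subset: "dim S \<le> dim T"
    and span_eq_of_dim_eq: "dim S = dim T \<Longrightarrow> span S = span T"
proof -
  obtain B where B: "B \<subseteq> S" "independent B" "S \<subseteq> span B" "card B = dim S"
    using basis_exists by blast
  \<comment> \<open>A basis of the smaller set that is contained in one of the larger set.\<close>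
  obtain C where C: "B \<subseteq> C" "C \<subseteq> T" "independent C" "T \<subseteq> span C"
    using maximal_independent_subset_extend[of B T] B assms by blast
  have card_C: "card C = dim T"
    by (rule basis_card_eq_dim) (use C in auto)
  have "finite C" using C assms finite_subset by blast
  show "dim S \<le> dim T"
    using card_mono[OF \<open>finite C\<close> C(1)] B(4) card_C by simp
  assume "dim S = dim T"
  then have "B = C"
    using card_subset_eq[OF \<open>finite C\<close> C(1)] B(4) card_C by simp
  then have "T \<subseteq> span S"
    using C(4) span_mono[OF B(1)] by blast
  then show "span S = span T"
    using assms(1) by (meson span_minimal span_mono subset_antisym subspace_span)
qed

lemma (in vector_space) dim_pos:
  assumes "finite S" "a \<in> S" "a \<noteq> 0"
  shows "1 \<le> dim S"
  using dim_le_of_subset[of "{a}" S] assms dim_eq_card_independent[of "{a}"] by simp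

section \<open>Products twisted by a field involution\<close>

locale field_involution =
  fixes \<sigma> :: "'k::field \<Rightarrow> 'k"
  assumes add: "\<sigma> (a + b) = \<sigma> a + \<sigma> b"
    and mult: "\<sigma> (a * b) = \<sigma> a * \<sigma> b"
    and involution: "\<sigma> (\<sigma> a) = a"
begin

lemma zero [simp]: "\<sigma> 0 = 0"
  using add[of 0 0] by (metis add_cancel_right_right)

lemma one [simp]: "\<sigma> 1 = 1"
  using mult[of "\<sigma> 1" 1] involution[of 1] by simp

lemma sum: "\<sigma> (\<Sum>i\<in>I. f i) = (\<Sum>i\<in>I. \<sigma> (f i))"
  by (induction I rule: infinite_finite_induct) (auto simp: add)

definition form :: "'i set \<Rightarrow> ('i \<Rightarrow> 'k) \<Rightarrow> ('i \<Rightarrow> 'k) \<Rightarrow> 'k" where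
  "form I a b = (\<Sum>i\<in>I. a i * \<sigma> (b i))"

lemma form_add_left: "form I (a + a') b = form I a b + form I a' b"
  by (simp add: form_def algebra_simps sum.distrib)

lemma form_scale_left: "form I (fn_scale c a) b = c * form I a b"
  by (simp add: form_def sum_distrib_left mult.assoc)

lemma form_swap: "form I b a = \<sigma> (form I a b)"
  by (simp add: form_def sum mult involution mult.commute)

lemma subspace_left_annihilator: "fn.subspace {a. form I a b = 0}"
  by (auto simp: fn.subspace_def form_add_left form_scale_left) (simp add: form_def)

lemma orthogonal_span_left:
  assumes "\<And>a. a \<in> A \<Longrightarrow> form I a b = 0" and "a \<in> fn.span A"
  shows "form I a b = 0"
  using fn.span_minimal[OF _ subspace_left_annihilator, of A I b] assms by blast

text \<open>
  Extend a basis \<open>C\<close> of the span of \<open>A\<close> to a basis \<open>D\<close> of the whole space.  An element of the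
  span of \<open>B\<close> is orthogonal to \<open>C\<close>, so by nondegeneracy it is determined by its products with the
  remaining \<open>card (D - C)\<close> vectors; these products are the coordinates of an injective linear map.
\<close>

lemma dim_add_dim_le_of_orthogonal:
  fixes I :: "'i set"
  assumes I: "finite I" and A: "A \<subseteq> supported I" and B: "B \<subseteq> supported I"
    and orth: "\<And>a b. a \<in> A \<Longrightarrow> b \<in> B \<Longrightarrow> form I a b = 0"
  shows "fn.dim A + fn.dim B \<le> card I"
proof -
  obtain C where C: "C \<subseteq> A" "fn.independent C" "A \<subseteq> fn.span C" "card C = fn.dim A"
    using fn.basis_exists by blast
  obtain D where D: "C \<subseteq> D" "D \<subseteq> supported I" "fn.independent D" "supported I \<subseteq> fn.span D"
    using fn.maximal_independent_subset_extend[of C "supported I"] C A by blast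
  have "finite D \<and> card D \<le> card (fn_unit ` I :: ('i \<Rightarrow> 'k) set)"
    using fn.independent_span_bound[of "fn_unit ` I" D] supported_subset_span_units[OF I] I D
    by blast
  then have "finite D" and card_D: "card D \<le> card I"
    using card_units_le[OF I, where 'b = 'k] by auto
  define \<phi> where "\<phi> w = (\<lambda>d. if d \<in> D - C then form I w d else 0)" for w
  interpret \<phi>: Vector_Spaces.linear fn_scale fn_scale \<phi>
    by unfold_locales
      (auto simp: \<phi>_def fun_eq_iff form_add_left form_scale_left)
  have inj: "inj_on \<phi> (fn.span B)"
  proof (subst \<phi>.inj_on_iff_eq_0[OF fn.subspace_span], intro ballI impI)
    fix w assume w: "w \<in> fn.span B" and "\<phi> w = 0"
    have w_D: "form I w d = 0" if "d \<in> D" for d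
    proof (cases "d \<in> C")
      case True
      then have "form I b d = 0" if "b \<in> B" for b
        using orth[of d b] C(1) that by (subst form_swap) auto
      then show ?thesis by (rule orthogonal_span_left[OF _ w])
    next
      case False
      then show ?thesis using fun_cong[OF \<open>\<phi> w = 0\<close>, of d] that by (simp add: \<phi>_def)
    qed
    have w_span: "form I d w = 0" if "d \<in> fn.span D" for d
      by (rule orthogonal_span_left[OF _ that]) (simp add: form_swap[of I _ w] w_D)
    have "w i = 0" for i
    proof (cases "i \<in> I")
      case True
      then have "fn_unit i \<in> fn.span D"
        using D(4) by (force simp: supported_def fn_unit_def)
      then have "form I w (fn_unit i) = 0"
        using w_span by (subst form_swap) simp
      moreover have "form I w (fn_unit i) = (\<Sum>j\<in>I. if j = i then w j else 0)"
        unfolding form_def by (rule sum.cong) (auto simp: fn_unit_def)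
      ultimately show ?thesis using True I by simp
    next
      case False
      moreover have "w \<in> supported I"
        using w B fn.span_minimal[OF _ subspace_supported] by blast
      ultimately show ?thesis by (simp add: supported_def)
    qed
    then show "w = 0" by auto
  qed
  obtain E where E: "E \<subseteq> B" "fn.independent E" "B \<subseteq> fn.span E" "card E = fn.dim B"
    using fn.basis_exists by blast
  have inj_E: "inj_on \<phi> (fn.span E)"
    using inj fn.span_mono[OF E(1)] inj_on_subset by blast
  have "fn.independent (\<phi> ` E)"
    by (rule \<phi>.independent_injective_image[OF E(2) inj_E])
  moreover have "\<phi> ` E \<subseteq> fn.span (fn_unit ` (D - C))"
    using supported_subset_span_units[of "D - C"] \<open>finite D\<close>
    by (force simp: \<phi>_def supported_def)
  ultimately have "card (\<phi> ` E) \<le> card (fn_unit ` (D - C) :: (('i \<Rightarrow> 'k) \<Rightarrow> 'k) set)"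
    using fn.independent_span_bound[of "fn_unit ` (D - C)" "\<phi> ` E"] \<open>finite D\<close> by blast
  also have "\<dots> \<le> card (D - C)"
    using \<open>finite D\<close> by (intro card_units_le) simp
  also have "\<dots> = card D - card C"
    using D(1) \<open>finite D\<close> by (meson card_Diff_subset finite_subset)
  finally have "card (\<phi> ` E) \<le> card D - card C" .
  moreover have "card (\<phi> ` E) = card E"
    using inj_E fn.span_superset by (meson card_image inj_on_subset)
  moreover have "card C \<le> card D"
    using D(1) \<open>finite D\<close> by (rule card_mono[rotated])
  ultimately show ?thesis using C(4) E(4) card_D by linarith
qed

end

section \<open>Bounding the cross-index\<close>

lemma Xind_le:
  assumes "order_preserving_Z2_map P (Q_poset n) \<phi>"
  shows "Xind P \<le> int n"
  unfolding Xind_def using assms by (auto intro!: Least_le exI)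

text \<open>
  The rank supplies the absolute value of a map to \<open>Q\<^sub>n\<close>.  For the sign, one of the two distinct
  labels of \<open>p\<close> and \<open>\<nu> p\<close> is selected by a choice depending only on the unordered pair of labels,
  and \<open>p\<close> is positive if its own label is the selected one.
\<close>

lemma (in free_Z2_poset) Xind_le_of_rank_and_label:
  fixes r :: "'p \<Rightarrow> nat" and s :: "'p \<Rightarrow> 'l"
  assumes r: "\<And>p. p \<in> elems P \<Longrightarrow> 1 \<le> r p \<and> r p \<le> n + 1"
    and r_nu: "\<And>p. p \<in> elems P \<Longrightarrow> r (nu P p) = r p"
    and s_nu: "\<And>p. p \<in> elems P \<Longrightarrow> s (nu P p) \<noteq> s p"
    and mono: "\<And>p q. (p, q) \<in> leq P \<Longrightarrow>
      r p < r q \<or> (r p = r q \<and> s p = s q \<and> s (nu P p) = s (nu P q))"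
  shows "Xind P \<le> int n"
proof (rule Xind_le)
  have leq_elems: "p \<in> elems P" "q \<in> elems P" if "(p, q) \<in> leq P" for p q
    using partial_order that by (auto simp: partial_order_on_def preorder_on_def)
  define sel where "sel p = (SOME z. z \<in> {s p, s (nu P p)})" for p
  have sel_in: "sel p \<in> {s p, s (nu P p)}" for p
    unfolding sel_def by (rule someI[of _ "s p"]) simp
  have sel_nu: "sel (nu P p) = sel p" if "p \<in> elems P" for p
    using nu_involution[OF that] by (simp add: sel_def insert_commute disj_commute)
  define \<phi> where "\<phi> p = (if sel p = s p then int (r p) else - int (r p))" for p
  have abs_\<phi>: "\<bar>\<phi> p\<bar> = int (r p)" for p
    by (simp add: \<phi>_def)
  have "\<phi> (nu P p) = - \<phi> p" if "p \<in> elems P" for p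
    using sel_in[of p] sel_nu[OF that] s_nu[OF that] r_nu[OF that] by (auto simp: \<phi>_def)
  moreover have "1 \<le> \<bar>\<phi> p\<bar> \<and> \<bar>\<phi> p\<bar> \<le> int n + 1" if "p \<in> elems P" for p
    using r[OF that] by (simp add: abs_\<phi>)
  moreover have "\<phi> p = \<phi> q \<or> \<bar>\<phi> p\<bar> < \<bar>\<phi> q\<bar>" if "(p, q) \<in> leq P" for p q
    using mono[OF that] by (auto simp: abs_\<phi>) (simp add: \<phi>_def sel_def)
  ultimately show "order_preserving_Z2_map P (Q_poset n) \<phi>"
    using leq_elems unfolding order_preserving_Z2_map_def Q_poset_def Let_def by auto
qed

section \<open>Orthogonal representations bound the cross-index\<close>

text \<open>
  The rank of \<open>(X, Y)\<close> is \<open>dim U + dim W - 1\<close> and its label is \<open>U\<close>, so that swapping turns the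
  label into \<open>W\<close>.  If \<open>Hom(K\<^sub>2, G)\<close> is empty, its cross-index is \<open>-1\<close> and a single vertex
  suffices, as a vector with nonzero self-product needs at least one coordinate.
\<close>

lemma (in field_involution) Xind_Hom_K2_le:
  fixes G :: "('a, 'b) pre_digraph" and f :: "'a \<Rightarrow> 'i \<Rightarrow> 'k"
  assumes G: "graph G" and ne: "verts G \<noteq> {}" and I: "finite I"
    and supp: "\<And>v. v \<in> verts G \<Longrightarrow> f v \<in> supported I"
    and aniso: "\<And>v. v \<in> verts G \<Longrightarrow> form I (f v) (f v) \<noteq> 0"
    and orth: "\<And>u v. u \<rightarrow>\<^bsub>G\<^esub> v \<Longrightarrow> form I (f u) (f v) = 0"
  shows "Xind (Hom_K2 G) + 2 \<le> int (card I)"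
proof (cases "elems (Hom_K2 G) = {}")
  case True
  obtain v where "v \<in> verts G" using ne by blast
  then have "I \<noteq> {}" using aniso[of v] by (auto simp: form_def)
  then have "1 \<le> card I" using I by (simp add: Suc_le_eq card_gt_0_iff)
  then show ?thesis using True by (simp add: Xind_def)
next
  case False
  interpret graph G by fact
  interpret H: free_Z2_poset "Hom_K2 G" by (rule free_Z2_poset_Hom_K2[OF G])
  define d where "d X = fn.dim (f ` X)" for X
  have nz: "f v \<noteq> 0" if "v \<in> verts G" for v
    using aniso[OF that] by (auto simp: form_def)
  have elemD: "X \<subseteq> verts G" "Y \<subseteq> verts G" "finite X" "finite Y" "X \<noteq> {}" "Y \<noteq> {}"
    "\<And>x y. x \<in> X \<Longrightarrow> y \<in> Y \<Longrightarrow> form I (f x) (f y) = 0"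
    if "(X, Y) \<in> elems (Hom_K2 G)" for X Y
    using that orth finite_subset[OF _ finite_verts] by (auto simp: Hom_K2_def Let_def)
  have d_pos: "1 \<le> d X" if "X \<noteq> {}" "X \<subseteq> verts G" for X
  proof -
    from \<open>X \<noteq> {}\<close> obtain v where "v \<in> X" by blast
    then show ?thesis
      unfolding d_def using that nz finite_subset[OF _ finite_verts]
      by (intro fn.dim_pos[of _ "f v"]) auto
  qed
  have d_sum: "d X + d Y \<le> card I" if "(X, Y) \<in> elems (Hom_K2 G)" for X Y
    unfolding d_def using elemD[OF that] supp
    by (intro dim_add_dim_le_of_orthogonal[OF I]) auto
  have bounds: "1 \<le> d X \<and> 1 \<le> d Y \<and> d X + d Y \<le> card I"
    if "(X, Y) \<in> elems (Hom_K2 G)" for X Y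
    using d_pos[of X] d_pos[of Y] d_sum[OF that] elemD[OF that] by blast
  obtain X0 Y0 where "(X0, Y0) \<in> elems (Hom_K2 G)" using False by auto
  then have card_I: "2 \<le> card I" using bounds by fastforce
  have nu: "nu (Hom_K2 G) (X, Y) = (Y, X)" for X Y
    by (simp add: Hom_K2_def Let_def)
  have span_ne: "fn.span (f ` Y) \<noteq> fn.span (f ` X)" if "(X, Y) \<in> elems (Hom_K2 G)" for X Y
  proof
    assume eq: "fn.span (f ` Y) = fn.span (f ` X)"
    have "Y \<noteq> {}" using elemD(6)[OF that] .
    then obtain y where y: "y \<in> Y" by blast
    \<comment> \<open>Then \<open>f y\<close> lies in the span of vectors orthogonal to it.\<close>
    have "f y \<in> fn.span (f ` X)" using fn.span_base[of "f y" "f ` Y"] y eq by blast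
    then have "form I (f y) (f y) = 0"
      using elemD(7)[OF that _ y] by (auto intro: orthogonal_span_left[of "f ` X"])
    then show False using aniso y elemD[OF that] by blast
  qed
  have d_mono: "d X \<le> d X' \<and> (d X = d X' \<longrightarrow> fn.span (f ` X) = fn.span (f ` X'))"
    if "X \<subseteq> X'" "finite X'" for X X'
    unfolding d_def using fn.dim_mono_finite[of "f ` X" "f ` X'"] that by blast
  have "Xind (Hom_K2 G) \<le> int (card I - 2)"
  proof (rule H.Xind_le_of_rank_and_label
      [where r = "\<lambda>(X, Y). d X + d Y - 1" and s = "\<lambda>(X, Y). fn.span (f ` X)"])
    fix p assume "p \<in> elems (Hom_K2 G)"
    moreover obtain X Y where "p = (X, Y)" by fastforce
    ultimately have p: "(X, Y) \<in> elems (Hom_K2 G)" "p = (X, Y)" by auto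
    show "1 \<le> (case p of (X, Y) \<Rightarrow> d X + d Y - 1) \<and>
        (case p of (X, Y) \<Rightarrow> d X + d Y - 1) \<le> card I - 2 + 1"
      using bounds[OF p(1)] card_I p(2) by auto
    show "(case nu (Hom_K2 G) p of (X, Y) \<Rightarrow> d X + d Y - 1) = (case p of (X, Y) \<Rightarrow> d X + d Y - 1)"
      by (simp add: p(2) nu)
    show "(case nu (Hom_K2 G) p of (X, Y) \<Rightarrow> fn.span (f ` X)) \<noteq> (case p of (X, Y) \<Rightarrow> fn.span (f ` X))"
      using span_ne[OF p(1)] by (simp add: p(2) nu)
  next
    fix p q assume "(p, q) \<in> leq (Hom_K2 G)"
    moreover obtain X Y X' Y' where pq: "p = (X, Y)" "q = (X', Y')" by fastforce
    ultimately have le: "(X, Y) \<in> elems (Hom_K2 G)" "(X', Y') \<in> elems (Hom_K2 G)"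
        "X \<subseteq> X'" "Y \<subseteq> Y'"
      by (auto simp: Hom_K2_def Let_def)
    have "finite X'" "finite Y'" using elemD[OF le(2)] by auto
    note mono = d_mono[OF le(3) this(1)] d_mono[OF le(4) this(2)]
    show "(case p of (X, Y) \<Rightarrow> d X + d Y - 1) < (case q of (X, Y) \<Rightarrow> d X + d Y - 1) \<or>
      ((case p of (X, Y) \<Rightarrow> d X + d Y - 1) = (case q of (X, Y) \<Rightarrow> d X + d Y - 1) \<and>
       (case p of (X, Y) \<Rightarrow> fn.span (f ` X)) = (case q of (X, Y) \<Rightarrow> fn.span (f ` X)) \<and>
       (case nu (Hom_K2 G) p of (X, Y) \<Rightarrow> fn.span (f ` X)) =
       (case nu (Hom_K2 G) q of (X, Y) \<Rightarrow> fn.span (f ` X)))"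
    proof (cases "d X = d X' \<and> d Y = d Y'")
      case True
      then show ?thesis using mono by (simp add: pq nu)
    next
      case False
      then have "d X + d Y < d X' + d Y'" using mono by linarith
      then have "d X + d Y - 1 < d X' + d Y' - 1" using bounds[OF le(1)] by linarith
      then show ?thesis by (simp add: pq)
    qed
  qed
  then show ?thesis using card_I by linarith
qed

lemma (in field_involution) Xind_Hom_K2_le_orthogonality_dimension:
  fixes G :: "('a, 'b) pre_digraph" and ip :: "'k vec \<Rightarrow> 'k vec \<Rightarrow> 'k"
  assumes G: "graph G" and ne: "verts G \<noteq> {}"
    and ip: "\<And>t v w. v \<in> carrier_vec t \<Longrightarrow> w \<in> carrier_vec t \<Longrightarrow>
      ip v w = (\<Sum>i<t. v $ i * \<sigma> (w $ i))"
    and ex: "\<exists>t x. orthogonal_representation ip G t (x :: 'a \<Rightarrow> 'k vec)"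
  shows "Xind (Hom_K2 G) + 2 \<le> int (orthogonality_dimension ip G)"
proof -
  interpret graph G by fact
  define t where "t = orthogonality_dimension ip G"
  obtain x where x: "orthogonal_representation ip G t (x :: 'a \<Rightarrow> 'k vec)"
    using LeastI_ex[OF ex] unfolding t_def orthogonality_dimension_def by blast
  define f where "f v = (\<lambda>i. if i < t then x v $ i else 0)" for v
  have form: "form {..<t} (f u) (f v) = ip (x u) (x v)" if "u \<in> verts G" "v \<in> verts G" for u v
    using x that ip[of "x u" t "x v"]
    by (simp add: form_def f_def orthogonal_representation_def)
  have "Xind (Hom_K2 G) + 2 \<le> int (card {..<t})"
  proof (rule Xind_Hom_K2_le[OF G ne, of _ f])
    show "form {..<t} (f u) (f v) = 0" if "u \<rightarrow>\<^bsub>G\<^esub> v" for u v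
      using form[of u v] adj_in_verts[OF that] x that
      by (simp add: orthogonal_representation_def)
  qed (use form x in \<open>auto simp: f_def supported_def orthogonal_representation_def\<close>)
  then show ?thesis by (simp add: t_def)
qed

theorem corollary2:
  fixes G :: "('a, 'b) pre_digraph"
  assumes "graph G" and "verts G \<noteq> {}"
  shows "int (orthogonality_dimension ((\<bullet>) :: 'k::field vec \<Rightarrow> 'k vec \<Rightarrow> 'k) G)
           \<ge> Xind (Hom_K2 G) + 2 \<and>
         int (orthogonality_dimension ((\<bullet>c) :: complex vec \<Rightarrow> complex vec \<Rightarrow> complex) G)
           \<ge> Xind (Hom_K2 G) + 2"
proof
  interpret bilinear: field_involution "\<lambda>a :: 'k. a"
    by unfold_locales auto
  show "Xind (Hom_K2 G) + 2 \<le> int (orthogonality_dimension ((\<bullet>) :: 'k vec \<Rightarrow> 'k vec \<Rightarrow> 'k) G)"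
    using assms ex_orthogonal_representation(1)[OF assms(1), where 'k = 'k]
    by (intro bilinear.Xind_Hom_K2_le_orthogonality_dimension)
      (auto simp: scalar_prod_def atLeast0LessThan)
  interpret hermitian: field_involution "conjugate :: complex \<Rightarrow> complex"
    by unfold_locales (auto simp: conjugate_dist_add conjugate_dist_mul)
  show "Xind (Hom_K2 G) + 2
      \<le> int (orthogonality_dimension ((\<bullet>c) :: complex vec \<Rightarrow> complex vec \<Rightarrow> complex) G)"
    using assms ex_orthogonal_representation(2)[OF assms(1)]
    by (intro hermitian.Xind_Hom_K2_le_orthogonality_dimension)
      (auto simp: scalar_prod_def atLeast0LessThan)
qed

end
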